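(* Let $(G,\mu,\alpha,\beta)$ be a BiHom-algebra over a field $\mathbb K$ of characteristic $0$ and let $G^{\circ}\subseteq G^{*}$ be its Sweedler dual. Let $\mu^{*}:G^{*}\to (G\otimes G)^{*}$, $\mu^{*}(f)=f\circ\mu$, and let $\alpha^{*},\beta^{*}:G^{*}\to G^{*}$ be $\alpha^{*}(f)=f\circ\alpha$, $\beta^{*}(f)=f\circ\beta$. Put $\Delta=\mu^{*}|_{G^{\circ}}$, $\alpha^{\circ}=\alpha^{*}|_{G^{\circ}}$, $\beta^{\circ}=\beta^{*}|_{G^{\circ}}$. Then $(G^{\circ},\Delta,\beta^{\circ},\alpha^{\circ})$ is a BiHom-coalgebra (where $G^{\circ}\otimes G^{\circ}$ is regarded as a subspace of $(G\otimes G)^{*}$ via the canonical embedding; thus the assertion includes that $\Delta$ takes values in $G^{\circ}\otimes G^{\circ}$ and that $\alpha^{\circ},\beta^{\circ}$ map $G^{\circ}$ to itself).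
   Context: All vector spaces and tensor products are over a field $\mathbb K$ of characteristic $0$; spaces may be infinite-dimensional. $V^{*}$ denotes the full linear dual. A BiHom-algebra (BiHom-associative algebra) is a quadruple $(G,\mu,\alpha,\beta)$ with $G$ a vector space, $\mu:G\otimes G\to G$ linear, written $\mu(g\otimes h)=gh$, and $\alpha,\beta:G\to G$ linear with $\alpha\circ\beta=\beta\circ\alpha$, such that for all $g,h,k\in G$: $\alpha(g)(hk)=(gh)\beta(k)$, $\alpha(hk)=\alpha(h)\alpha(k)$, $\beta(hk)=\beta(h)\beta(k)$. No unit is assumed. An ideal of $G$ is a subspace $H\subseteq G$ with $\alpha(H)\subseteq H$, $\beta(H)\subseteq H$, and $ab\in H$, $ba\in H$ for all $a\in G$, $b\in H$. It is finite-codimensional if $\dim(G/H)<\infty$. The Sweedler dual (Sweedler duality, finite duality) of $G$ is $G^{\circ}=\{f\in G^{*}\mid \text{there is a finite-codimensional ideal } J\subseteq G \text{ with } f(J)=0\}$. A BiHom-coalgebra is a quadruple $(C,\Delta,\psi,\phi)$ (order of the twisting maps matters) with $C$ a vector space, $\Delta:C\to C\otimes C$ linear, $\psi,\phi:C\to C$ commuting linear maps, such that $(\phi\otimes\Delta)\circ\Delta=(\Delta\otimes\psi)\circ\Delta$, $\Delta\circ\psi=(\psi\otimes\psi)\circ\Delta$, $\Delta\circ\phi=(\phi\otimes\phi)\circ\Delta$. No counit is assumed. The canonical embedding $G^{*}\otimes G^{*}\hookrightarrow (G\otimes G)^{*}$ is $(f\otimes g)(x\otimes y)=f(x)g(y)$.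 *)

theory Defs
  imports Complex_Main "HOL-Library.Function_Algebras"
begin

text \<open>
  A vector space over the field \<open>'k\<close> is a subspace \<open>V\<close> (its carrier) of an
  ambient \<open>vector_space s\<close>; the carrier \<open>UNIV\<close> gives the ambient space itself.
\<close>

section \<open>Linear maps between carriers, dual spaces\<close>

definition linear_on ::
  "('k::field \<Rightarrow> 'a::ab_group_add \<Rightarrow> 'a) \<Rightarrow> 'a set \<Rightarrow> ('k \<Rightarrow> 'b::ab_group_add \<Rightarrow> 'b) \<Rightarrow> 'b set
    \<Rightarrow> ('a \<Rightarrow> 'b) \<Rightarrow> bool" where
  "linear_on s1 V s2 W f \<longleftrightarrow> f ` V \<subseteq> W
    \<and> (\<forall>x\<in>V. \<forall>y\<in>V. f (x + y) = f x + f y)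
    \<and> (\<forall>c. \<forall>x\<in>V. f (s1 c x) = s2 c (f x))"

definition fun_scale :: "'k::field \<Rightarrow> ('x \<Rightarrow> 'k) \<Rightarrow> 'x \<Rightarrow> 'k" where
  "fun_scale c f = (\<lambda>x. c * f x)"

lemma fun_scale_apply [simp]: "fun_scale c f x = c * f x"
  by (simp add: fun_scale_def)

global_interpretation fun_vs: vector_space fun_scale
  by unfold_locales (auto simp: fun_eq_iff algebra_simps)

text \<open>Functionals on \<open>V\<close> are extended by \<open>0\<close> outside of \<open>V\<close>, so that equal functionals
  are equal as HOL functions.\<close>

definition dual_space :: "('k::field \<Rightarrow> 'a::ab_group_add \<Rightarrow> 'a) \<Rightarrow> 'a set \<Rightarrow> ('a \<Rightarrow> 'k) set" where
  "dual_space s V = {f. linear_on s V (*) UNIV f \<and> (\<forall>x. x \<notin> V \<longrightarrow> f x = 0)}"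

section \<open>Tensor products\<close>

text \<open>
  \<open>V \<otimes> W\<close> is realised as the space of functionals on the bilinear forms on \<open>V \<times> W\<close>
  that is spanned by the evaluations \<open>x \<otimes> y = (\<lambda>b. b x y)\<close>.  The universal property is
  proved below (\<open>tensor_universal\<close>).
\<close>

definition bilinear_forms ::
  "('k::field \<Rightarrow> 'a::ab_group_add \<Rightarrow> 'a) \<Rightarrow> 'a set \<Rightarrow> ('k \<Rightarrow> 'b::ab_group_add \<Rightarrow> 'b) \<Rightarrow> 'b set
    \<Rightarrow> ('a \<Rightarrow> 'b \<Rightarrow> 'k) set" where
  "bilinear_forms s1 V s2 W = {b.
     (\<forall>y\<in>W. linear_on s1 V (*) UNIV (\<lambda>x. b x y)) \<and>
     (\<forall>x\<in>V. linear_on s2 W (*) UNIV (\<lambda>y. b x y))}"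

definition tens ::
  "('k::field \<Rightarrow> 'a::ab_group_add \<Rightarrow> 'a) \<Rightarrow> 'a set \<Rightarrow> ('k \<Rightarrow> 'b::ab_group_add \<Rightarrow> 'b) \<Rightarrow> 'b set
    \<Rightarrow> 'a \<Rightarrow> 'b \<Rightarrow> ('a \<Rightarrow> 'b \<Rightarrow> 'k) \<Rightarrow> 'k" where
  "tens s1 V s2 W x y = (\<lambda>b. if b \<in> bilinear_forms s1 V s2 W then b x y else 0)"

definition tensor_space ::
  "('k::field \<Rightarrow> 'a::ab_group_add \<Rightarrow> 'a) \<Rightarrow> 'a set \<Rightarrow> ('k \<Rightarrow> 'b::ab_group_add \<Rightarrow> 'b) \<Rightarrow> 'b set
    \<Rightarrow> (('a \<Rightarrow> 'b \<Rightarrow> 'k) \<Rightarrow> 'k) set" where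
  "tensor_space s1 V s2 W = fun_vs.span {tens s1 V s2 W x y | x y. x \<in> V \<and> y \<in> W}"

text \<open>\<open>f \<otimes> g : V \<otimes> W \<rightarrow> V' \<otimes> W'\<close>; only the target spaces enter the formula.
  See \<open>tensor_map_tens\<close>.\<close>

definition tensor_map ::
  "('k::field \<Rightarrow> 'c::ab_group_add \<Rightarrow> 'c) \<Rightarrow> 'c set \<Rightarrow> ('k \<Rightarrow> 'd::ab_group_add \<Rightarrow> 'd) \<Rightarrow> 'd set
    \<Rightarrow> ('a::ab_group_add \<Rightarrow> 'c) \<Rightarrow> ('b::ab_group_add \<Rightarrow> 'd)
    \<Rightarrow> (('a \<Rightarrow> 'b \<Rightarrow> 'k) \<Rightarrow> 'k) \<Rightarrow> ('c \<Rightarrow> 'd \<Rightarrow> 'k) \<Rightarrow> 'k" where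
  "tensor_map s1' V' s2' W' f g t =
     (\<lambda>b. if b \<in> bilinear_forms s1' V' s2' W' then t (\<lambda>x y. b (f x) (g y)) else 0)"

text \<open>The canonical isomorphism \<open>V \<otimes> (W \<otimes> U) \<rightarrow> (V \<otimes> W) \<otimes> U\<close>.
  See \<open>tensor_assoc_tens\<close>.\<close>

definition tensor_assoc ::
  "('k::field \<Rightarrow> 'a::ab_group_add \<Rightarrow> 'a) \<Rightarrow> 'a set \<Rightarrow> ('k \<Rightarrow> 'b::ab_group_add \<Rightarrow> 'b) \<Rightarrow> 'b set
    \<Rightarrow> ('k \<Rightarrow> 'c::ab_group_add \<Rightarrow> 'c) \<Rightarrow> 'c set
    \<Rightarrow> (('a \<Rightarrow> (('b \<Rightarrow> 'c \<Rightarrow> 'k) \<Rightarrow> 'k) \<Rightarrow> 'k) \<Rightarrow> 'k)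
    \<Rightarrow> ((('a \<Rightarrow> 'b \<Rightarrow> 'k) \<Rightarrow> 'k) \<Rightarrow> 'c \<Rightarrow> 'k) \<Rightarrow> 'k" where
  "tensor_assoc s1 V s2 W s3 U t =
     (\<lambda>b. if b \<in> bilinear_forms fun_scale (tensor_space s1 V s2 W) s3 U
          then t (\<lambda>x r. r (\<lambda>y z. b (tens s1 V s2 W x y) z)) else 0)"

text \<open>The canonical embedding of \<open>V\<^sup>* \<otimes> W\<^sup>*\<close>, or of \<open>D \<otimes> E\<close> for subspaces \<open>D\<close> of \<open>V\<^sup>*\<close> and
  \<open>E\<close> of \<open>W\<^sup>*\<close>, into \<open>(V \<otimes> W)\<^sup>*\<close>.  See \<open>canonical_embedding_tens\<close> and
  \<open>inj_on_canonical_embedding\<close>.\<close>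

definition canonical_embedding ::
  "('k::field \<Rightarrow> 'a::ab_group_add \<Rightarrow> 'a) \<Rightarrow> 'a set \<Rightarrow> ('k \<Rightarrow> 'b::ab_group_add \<Rightarrow> 'b) \<Rightarrow> 'b set
    \<Rightarrow> ((('a \<Rightarrow> 'k) \<Rightarrow> ('b \<Rightarrow> 'k) \<Rightarrow> 'k) \<Rightarrow> 'k) \<Rightarrow> (('a \<Rightarrow> 'b \<Rightarrow> 'k) \<Rightarrow> 'k) \<Rightarrow> 'k" where
  "canonical_embedding s1 V s2 W t =
     (\<lambda>u. if u \<in> tensor_space s1 V s2 W then t (\<lambda>f g. u (\<lambda>x y. f x * g y)) else 0)"

section \<open>BiHom-algebras and the Sweedler dual\<close>

locale bihom_algebra = vector_space scale
  for scale :: "'k::field_char_0 \<Rightarrow> 'g::ab_group_add \<Rightarrow> 'g" +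
  fixes \<mu> :: "(('g \<Rightarrow> 'g \<Rightarrow> 'k) \<Rightarrow> 'k) \<Rightarrow> 'g"
    and \<alpha> \<beta> :: "'g \<Rightarrow> 'g"
  assumes linear_\<mu>: "linear_on fun_scale (tensor_space scale UNIV scale UNIV) scale UNIV \<mu>"
    and linear_\<alpha>: "Vector_Spaces.linear scale scale \<alpha>"
    and linear_\<beta>: "Vector_Spaces.linear scale scale \<beta>"
    and commute: "\<alpha> \<circ> \<beta> = \<beta> \<circ> \<alpha>"
    and bihom_assoc:
      "\<mu> (tens scale UNIV scale UNIV (\<alpha> g) (\<mu> (tens scale UNIV scale UNIV h k)))
       = \<mu> (tens scale UNIV scale UNIV (\<mu> (tens scale UNIV scale UNIV g h)) (\<beta> k))"
    and \<alpha>_mult: "\<alpha> (\<mu> (tens scale UNIV scale UNIV h k))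
       = \<mu> (tens scale UNIV scale UNIV (\<alpha> h) (\<alpha> k))"
    and \<beta>_mult: "\<beta> (\<mu> (tens scale UNIV scale UNIV h k))
       = \<mu> (tens scale UNIV scale UNIV (\<beta> h) (\<beta> k))"
begin

definition ideal :: "'g set \<Rightarrow> bool" where
  "ideal H \<longleftrightarrow> subspace H \<and> \<alpha> ` H \<subseteq> H \<and> \<beta> ` H \<subseteq> H
    \<and> (\<forall>a. \<forall>b\<in>H. \<mu> (tens scale UNIV scale UNIV a b) \<in> H \<and> \<mu> (tens scale UNIV scale UNIV b a) \<in> H)"

text \<open>The vector space operations of \<open>G/H\<close> are those of representatives, so
  \<open>dim (G/H) < \<infinity>\<close> says that \<open>G/H\<close> is the image of the span of a finite set.\<close>

definition finite_codimensional :: "'g set \<Rightarrow> bool" where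
  "finite_codimensional H \<longleftrightarrow>
     (\<exists>B. finite B \<and> (\<lambda>x. {(x, y). x - y \<in> H} `` {x}) ` span B = UNIV // {(x, y). x - y \<in> H})"

definition sweedler_dual :: "('g \<Rightarrow> 'k) set" where
  "sweedler_dual = {f \<in> dual_space scale UNIV.
     \<exists>J. ideal J \<and> finite_codimensional J \<and> f ` J \<subseteq> {0}}"

definition mu_star :: "('g \<Rightarrow> 'k) \<Rightarrow> (('g \<Rightarrow> 'g \<Rightarrow> 'k) \<Rightarrow> 'k) \<Rightarrow> 'k" where
  "mu_star f = (\<lambda>u. if u \<in> tensor_space scale UNIV scale UNIV then f (\<mu> u) else 0)"

definition alpha_star :: "('g \<Rightarrow> 'k) \<Rightarrow> 'g \<Rightarrow> 'k" where
  "alpha_star f = f \<circ> \<alpha>"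

definition beta_star :: "('g \<Rightarrow> 'k) \<Rightarrow> 'g \<Rightarrow> 'k" where
  "beta_star f = f \<circ> \<beta>"

text \<open>The corestriction of \<open>\<mu>\<^sup>*\<close> to \<open>G\<^sup>\<circ> \<otimes> G\<^sup>\<circ>\<close>; meaningful only if \<open>\<mu>\<^sup>*\<close> maps \<open>G\<^sup>\<circ>\<close> into the image
  of \<open>G\<^sup>\<circ> \<otimes> G\<^sup>\<circ>\<close> under the (injective) canonical embedding.\<close>

definition sweedler_comult ::
  "('g \<Rightarrow> 'k) \<Rightarrow> (('g \<Rightarrow> 'k) \<Rightarrow> ('g \<Rightarrow> 'k) \<Rightarrow> 'k) \<Rightarrow> 'k" where
  "sweedler_comult f =
     inv_into (tensor_space fun_scale sweedler_dual fun_scale sweedler_dual)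
       (canonical_embedding scale UNIV scale UNIV) (mu_star f)"

end

section \<open>BiHom-coalgebras\<close>

locale bihom_coalgebra = vector_space scale
  for scale :: "'k::field_char_0 \<Rightarrow> 'c::ab_group_add \<Rightarrow> 'c" +
  fixes C :: "'c set"
    and \<Delta> :: "'c \<Rightarrow> ('c \<Rightarrow> 'c \<Rightarrow> 'k) \<Rightarrow> 'k"
    and \<psi> \<phi> :: "'c \<Rightarrow> 'c"
  assumes subspace_C: "subspace C"
    and linear_\<Delta>: "linear_on scale C fun_scale (tensor_space scale C scale C) \<Delta>"
    and linear_\<psi>: "linear_on scale C scale C \<psi>"
    and linear_\<phi>: "linear_on scale C scale C \<phi>"
    and commute: "c \<in> C \<Longrightarrow> \<psi> (\<phi> c) = \<phi> (\<psi> c)"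
    and bihom_coassoc: "c \<in> C \<Longrightarrow>
      tensor_assoc scale C scale C scale C
        (tensor_map scale C fun_scale (tensor_space scale C scale C) \<phi> \<Delta> (\<Delta> c))
      = tensor_map fun_scale (tensor_space scale C scale C) scale C \<Delta> \<psi> (\<Delta> c)"
    and \<Delta>_\<psi>: "c \<in> C \<Longrightarrow> \<Delta> (\<psi> c) = tensor_map scale C scale C \<psi> \<psi> (\<Delta> c)"
    and \<Delta>_\<phi>: "c \<in> C \<Longrightarrow> \<Delta> (\<phi> c) = tensor_map scale C scale C \<phi> \<phi> (\<Delta> c)"

section \<open>Basic properties of the tensor product\<close>

lemma linear_onD:
  assumes "linear_on s1 V s2 W f"
  shows "x \<in> V \<Longrightarrow> f x \<in> W" "x \<in> V \<Longrightarrow> y \<in> V \<Longrightarrow> f (x + y) = f x + f y"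
    "x \<in> V \<Longrightarrow> f (s1 c x) = s2 c (f x)"
  using assms by (auto simp: linear_on_def)

lemma bilinear_formsD:
  assumes "b \<in> bilinear_forms s1 V s2 W" "x \<in> V" "y \<in> W"
  shows "x' \<in> V \<Longrightarrow> b (x + x') y = b x y + b x' y" "b (s1 c x) y = c * b x y"
    "y' \<in> W \<Longrightarrow> b x (y + y') = b x y + b x y'" "b x (s2 c y) = c * b x y"
  using assms by (auto simp: bilinear_forms_def linear_on_def)

lemma bilinear_formsI:
  assumes "\<And>x x' y. x \<in> V \<Longrightarrow> x' \<in> V \<Longrightarrow> y \<in> W \<Longrightarrow> b (x + x') y = b x y + b x' y"
    "\<And>c x y. x \<in> V \<Longrightarrow> y \<in> W \<Longrightarrow> b (s1 c x) y = c * b x y"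
    "\<And>x y y'. x \<in> V \<Longrightarrow> y \<in> W \<Longrightarrow> y' \<in> W \<Longrightarrow> b x (y + y') = b x y + b x y'"
    "\<And>c x y. x \<in> V \<Longrightarrow> y \<in> W \<Longrightarrow> b x (s2 c y) = c * b x y"
  shows "b \<in> bilinear_forms s1 V s2 W"
  using assms by (auto simp: bilinear_forms_def linear_on_def)

lemma tens_bilinear:
  assumes "x \<in> V" "y \<in> W"
  shows "x' \<in> V \<Longrightarrow> tens s1 V s2 W (x + x') y = tens s1 V s2 W x y + tens s1 V s2 W x' y"
    "tens s1 V s2 W (s1 c x) y = fun_scale c (tens s1 V s2 W x y)"
    "y' \<in> W \<Longrightarrow> tens s1 V s2 W x (y + y') = tens s1 V s2 W x y + tens s1 V s2 W x y'"
    "tens s1 V s2 W x (s2 c y) = fun_scale c (tens s1 V s2 W x y)"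
  using assms by (auto simp: tens_def fun_eq_iff bilinear_formsD)

lemma tens_in_tensor_space: "x \<in> V \<Longrightarrow> y \<in> W \<Longrightarrow> tens s1 V s2 W x y \<in> tensor_space s1 V s2 W"
  unfolding tensor_space_def by (rule fun_vs.span_base) blast

lemma subspace_tensor_space: "fun_vs.subspace (tensor_space s1 V s2 W)"
  unfolding tensor_space_def by simp

lemma tensor_induct [consumes 1, case_names zero tens add scale]:
  assumes "t \<in> tensor_space s1 V s2 W"
    and zero: "P 0"
    and tens: "\<And>x y. x \<in> V \<Longrightarrow> y \<in> W \<Longrightarrow> P (tens s1 V s2 W x y)"
    and add: "\<And>t u. t \<in> tensor_space s1 V s2 W \<Longrightarrow> u \<in> tensor_space s1 V s2 W \<Longrightarrow> P t \<Longrightarrow> P u \<Longrightarrow> P (t + u)"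
    and scale: "\<And>c t. t \<in> tensor_space s1 V s2 W \<Longrightarrow> P t \<Longrightarrow> P (fun_scale c t)"
  shows "P t"
proof -
  let ?S = "tensor_space s1 V s2 W"
  have *: "fun_vs.subspace {t \<in> ?S. P t}"
    using subspace_tensor_space[of s1 V s2 W] zero add scale
    by (auto simp: fun_vs.subspace_def)
  have "?S \<subseteq> {t \<in> ?S. P t}"
    unfolding tensor_space_def[of s1 V s2 W]
    by (rule fun_vs.span_minimal)
      (use * tens tens_in_tensor_space[of _ V _ W s1 s2] in \<open>auto simp: tensor_space_def\<close>)
  with assms(1) show ?thesis by blast
qed

lemma tensor_on_forms:
  assumes "t \<in> tensor_space s1 V s2 W" "b \<in> bilinear_forms s1 V s2 W"
  shows tensor_forms_add: "b' \<in> bilinear_forms s1 V s2 W \<Longrightarrow> t (\<lambda>x y. b x y + b' x y) = t b + t b'"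
    and tensor_forms_scale: "t (\<lambda>x y. c * b x y) = c * t b"
    and tensor_forms_cong: "b' \<in> bilinear_forms s1 V s2 W \<Longrightarrow>
      (\<And>x y. x \<in> V \<Longrightarrow> y \<in> W \<Longrightarrow> b x y = b' x y) \<Longrightarrow> t b = t b'"
proof -
  have sc: "(\<lambda>x y. c * b x y) \<in> bilinear_forms s1 V s2 W"
    by (rule bilinear_formsI) (use assms(2) in \<open>simp_all add: bilinear_formsD algebra_simps\<close>)
  show "t (\<lambda>x y. c * b x y) = c * t b"
    using assms(1) by (induction rule: tensor_induct)
      (use sc assms(2) in \<open>auto simp: tens_def algebra_simps\<close>)
  assume b': "b' \<in> bilinear_forms s1 V s2 W"
  have ad: "(\<lambda>x y. b x y + b' x y) \<in> bilinear_forms s1 V s2 W"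
    by (rule bilinear_formsI) (use assms(2) b' in \<open>simp_all add: bilinear_formsD algebra_simps\<close>)
  show "t (\<lambda>x y. b x y + b' x y) = t b + t b'"
    using assms(1) by (induction rule: tensor_induct)
      (use ad b' assms(2) in \<open>auto simp: tens_def algebra_simps\<close>)
  assume eq: "\<And>x y. x \<in> V \<Longrightarrow> y \<in> W \<Longrightarrow> b x y = b' x y"
  show "t b = t b'"
    using assms(1) by (induction rule: tensor_induct)
      (use eq b' assms(2) in \<open>auto simp: tens_def\<close>)
qed

theorem tensor_universal:
  fixes s1 :: "'k::field \<Rightarrow> 'a::ab_group_add \<Rightarrow> 'a" and s2 :: "'k \<Rightarrow> 'b::ab_group_add \<Rightarrow> 'b"
    and s3 :: "'k \<Rightarrow> 'c::ab_group_add \<Rightarrow> 'c"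
  assumes "vector_space s3" "module.subspace s3 U"
    and b: "\<And>y. y \<in> W \<Longrightarrow> linear_on s1 V s3 U (\<lambda>x. b x y)"
      "\<And>x. x \<in> V \<Longrightarrow> linear_on s2 W s3 U (b x)"
  shows "\<exists>L. linear_on fun_scale (tensor_space s1 V s2 W) s3 U L
      \<and> (\<forall>x\<in>V. \<forall>y\<in>W. L (tens s1 V s2 W x y) = b x y)"
    and "linear_on fun_scale (tensor_space s1 V s2 W) s3 U L \<Longrightarrow>
      linear_on fun_scale (tensor_space s1 V s2 W) s3 U L' \<Longrightarrow>
      (\<And>x y. x \<in> V \<Longrightarrow> y \<in> W \<Longrightarrow> L (tens s1 V s2 W x y) = L' (tens s1 V s2 W x y)) \<Longrightarrow>
      t \<in> tensor_space s1 V s2 W \<Longrightarrow> L t = L' t"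
proof -
  let ?T = "tensor_space s1 V s2 W"
  interpret U: vector_space s3 by fact
  have [simp]: "vector_space ((*) :: 'k \<Rightarrow> 'k \<Rightarrow> 'k)"
    by unfold_locales (auto simp: algebra_simps)
  interpret P: vector_space_pair s3 "(*) :: 'k \<Rightarrow> 'k \<Rightarrow> 'k"
    by (simp add: vector_space_pair_def U.vector_space_axioms)
  let ?F = "{f. Vector_Spaces.linear s3 ((*) :: 'k \<Rightarrow> 'k \<Rightarrow> 'k) f}"
  have sep: "u = v" if "\<And>f. f \<in> ?F \<Longrightarrow> f u = f v" for u v
  proof (rule ccontr)
    assume "u \<noteq> v"
    then have "U.independent {u - v}" by simp
    then obtain f where f: "Vector_Spaces.linear s3 (*) f" "f (u - v) = (1::'k)"
      using P.linear_independent_extend[of "{u - v}" "\<lambda>_. 1"] by auto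
    from f(1) have "f (u - v) = f u - f v" by (rule P.linear_diff)
    with f(2) that[of f] f(1) show False by simp
  qed
  have form: "(\<lambda>x y. f (b x y)) \<in> bilinear_forms s1 V s2 W" if "f \<in> ?F" for f
    using that b by (intro bilinear_formsI)
      (auto simp: linear_on_def Vector_Spaces.linear_iff)
  have ex: "\<exists>u\<in>U. \<forall>f\<in>?F. f u = t (\<lambda>x y. f (b x y))" if "t \<in> ?T" for t
    using that
  proof (induction rule: tensor_induct)
    case zero
    show ?case using U.subspace_0[OF assms(2)] P.linear_0 by (intro bexI[of _ 0]) auto
  next
    case (tens x y)
    then show ?case using form b(1)[of y]
      by (intro bexI[of _ "b x y"]) (auto simp: tens_def linear_on_def)
  next
    case (add t t')
    then obtain u u' where "u \<in> U" "u' \<in> U" "\<forall>f\<in>?F. f u = t (\<lambda>x y. f (b x y))"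
      "\<forall>f\<in>?F. f u' = t' (\<lambda>x y. f (b x y))" by blast
    then show ?case using U.subspace_add[OF assms(2)]
      by (intro bexI[of _ "u + u'"]) (auto simp: Vector_Spaces.linear_iff)
  next
    case (scale c t)
    then obtain u where "u \<in> U" "\<forall>f\<in>?F. f u = t (\<lambda>x y. f (b x y))" by blast
    then show ?case using U.subspace_scale[OF assms(2)]
      by (intro bexI[of _ "s3 c u"]) (auto simp: Vector_Spaces.linear_iff)
  qed
  then obtain L where L: "\<And>t. t \<in> ?T \<Longrightarrow> L t \<in> U"
    "\<And>t f. t \<in> ?T \<Longrightarrow> f \<in> ?F \<Longrightarrow> f (L t) = t (\<lambda>x y. f (b x y))" by metis
  have "linear_on fun_scale ?T s3 U L"
    unfolding linear_on_def
  proof (intro conjI ballI allI)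
    show "L ` ?T \<subseteq> U" using L(1) by blast
  next
    fix t u assume tu: "t \<in> ?T" "u \<in> ?T"
    then have "t + u \<in> ?T" by (rule fun_vs.subspace_add[OF subspace_tensor_space])
    with tu show "L (t + u) = L t + L u"
      by (intro sep) (simp add: L(2)[simplified] Vector_Spaces.linear_iff)
  next
    fix c t assume t: "t \<in> ?T"
    then have "fun_scale c t \<in> ?T" by (rule fun_vs.subspace_scale[OF subspace_tensor_space])
    with t show "L (fun_scale c t) = s3 c (L t)"
      by (intro sep) (simp add: L(2)[simplified] Vector_Spaces.linear_iff)
  qed
  moreover have "L (tens s1 V s2 W x y) = b x y" if "x \<in> V" "y \<in> W" for x y
  proof (rule sep)
    fix f assume f: "f \<in> ?F"
    show "f (L (tens s1 V s2 W x y)) = f (b x y)"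
      unfolding L(2)[OF tens_in_tensor_space[OF that] f] using form[OF f] by (simp add: tens_def)
  qed
  ultimately show "\<exists>L. linear_on fun_scale ?T s3 U L
      \<and> (\<forall>x\<in>V. \<forall>y\<in>W. L (tens s1 V s2 W x y) = b x y)" by blast
next
  let ?T = "tensor_space s1 V s2 W"
  interpret U: vector_space s3 by fact
  assume L: "linear_on fun_scale ?T s3 U L" and L': "linear_on fun_scale ?T s3 U L'"
    and eq: "\<And>x y. x \<in> V \<Longrightarrow> y \<in> W \<Longrightarrow> L (tens s1 V s2 W x y) = L' (tens s1 V s2 W x y)"
  assume "t \<in> ?T"
  then show "L t = L' t"
  proof (induction rule: tensor_induct)
    case zero
    have "fun_scale 0 0 = (0 :: ('a \<Rightarrow> 'b \<Rightarrow> 'k) \<Rightarrow> 'k)" by simp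
    moreover have "(0 :: ('a \<Rightarrow> 'b \<Rightarrow> 'k) \<Rightarrow> 'k) \<in> ?T"
      by (rule fun_vs.subspace_0[OF subspace_tensor_space])
    ultimately show ?case
      using linear_onD(3)[OF L, of 0 0] linear_onD(3)[OF L', of 0 0] U.scale_zero_left by metis
  next
    case (tens x y)
    then show ?case by (rule eq)
  next
    case (add t u)
    show ?case unfolding linear_onD(2)[OF L add(1,2)] linear_onD(2)[OF L' add(1,2)] add(3,4) ..
  next
    case (scale c t)
    show ?case unfolding linear_onD(3)[OF L scale(1)] linear_onD(3)[OF L' scale(1)] scale(2) ..
  qed
qed

lemma tensor_map_form:
  assumes "linear_on s1 V s1' V' f" "linear_on s2 W s2' W' g" "b \<in> bilinear_forms s1' V' s2' W'"
  shows "(\<lambda>x y. b (f x) (g y)) \<in> bilinear_forms s1 V s2 W"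
  by (rule bilinear_formsI)
    (simp_all add: linear_onD[OF assms(1)] linear_onD[OF assms(2)] bilinear_formsD[OF assms(3)])

lemma tensor_map_tens:
  assumes "linear_on s1 V s1' V' f" "linear_on s2 W s2' W' g"
  shows "tensor_map s1' V' s2' W' f g (tens s1 V s2 W x y) = tens s1' V' s2' W' (f x) (g y)"
  using tensor_map_form[OF assms] by (auto simp: tensor_map_def tens_def fun_eq_iff)

lemma linear_on_tensor_map:
  assumes "linear_on s1 V s1' V' f" "linear_on s2 W s2' W' g"
  shows "linear_on fun_scale (tensor_space s1 V s2 W) fun_scale (tensor_space s1' V' s2' W')
    (tensor_map s1' V' s2' W' f g)"
proof -
  let ?m = "tensor_map s1' V' s2' W' f g"
  have ad: "?m (t + u) = ?m t + ?m u" for t u by (auto simp: tensor_map_def fun_eq_iff)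
  have sc: "?m (fun_scale c t) = fun_scale c (?m t)" for c t
    by (auto simp: tensor_map_def fun_eq_iff)
  have "?m t \<in> tensor_space s1' V' s2' W'" if "t \<in> tensor_space s1 V s2 W" for t
    using that
  proof (induction rule: tensor_induct)
    case zero
    have "?m 0 = 0" by (auto simp: tensor_map_def fun_eq_iff)
    then show ?case using fun_vs.subspace_0[OF subspace_tensor_space] by metis
  next
    case (tens x y)
    then show ?case
      by (simp add: tensor_map_tens[OF assms] tens_in_tensor_space linear_onD[OF assms(1)]
          linear_onD[OF assms(2)])
  next
    case (add t u)
    show ?case unfolding ad by (rule fun_vs.subspace_add[OF subspace_tensor_space add(3,4)])
  next
    case (scale c t)
    show ?case unfolding sc by (rule fun_vs.subspace_scale[OF subspace_tensor_space scale(2)])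
  qed
  with ad sc show ?thesis by (auto simp: linear_on_def)
qed

lemma tensor_assoc_form:
  assumes V: "vector_space s1" "module.subspace s1 V"
    and b: "b \<in> bilinear_forms fun_scale (tensor_space s1 V s2 W) s3 U"
  shows "x \<in> V \<Longrightarrow> (\<lambda>y z. b (tens s1 V s2 W x y) z) \<in> bilinear_forms s2 W s3 U"
    and "(\<lambda>x r. r (\<lambda>y z. b (tens s1 V s2 W x y) z))
      \<in> bilinear_forms s1 V fun_scale (tensor_space s2 W s3 U)"
proof -
  interpret V: vector_space s1 by fact
  have 1: "(\<lambda>y z. b (tens s1 V s2 W x y) z) \<in> bilinear_forms s2 W s3 U" if "x \<in> V" for x
    by (rule bilinear_formsI)
      (use that in \<open>simp_all add: tens_bilinear tens_in_tensor_space bilinear_formsD[OF b]\<close>)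
  then show "x \<in> V \<Longrightarrow> (\<lambda>y z. b (tens s1 V s2 W x y) z) \<in> bilinear_forms s2 W s3 U" .
  have 2: "r (\<lambda>y z. b (tens s1 V s2 W (x + x') y) z) =
      r (\<lambda>y z. b (tens s1 V s2 W x y) z) + r (\<lambda>y z. b (tens s1 V s2 W x' y) z)"
    if "x \<in> V" "x' \<in> V" "r \<in> tensor_space s2 W s3 U" for x x' r
  proof -
    have sum: "(\<lambda>y z. b (tens s1 V s2 W (x + x') y) z) \<in> bilinear_forms s2 W s3 U"
      by (rule 1, rule V.subspace_add[OF V(2)]) fact+
    show ?thesis using that(3)
      by (induction rule: tensor_induct)
        (use sum that(1,2) 1 in \<open>auto simp: tens_def[of s2 W s3 U] tens_bilinear
          tens_in_tensor_space bilinear_formsD[OF b] algebra_simps\<close>)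
  qed
  have 3: "r (\<lambda>y z. b (tens s1 V s2 W (s1 c x) y) z) = c * r (\<lambda>y z. b (tens s1 V s2 W x y) z)"
    if "x \<in> V" "r \<in> tensor_space s2 W s3 U" for c x r
  proof -
    have sc: "(\<lambda>y z. b (tens s1 V s2 W (s1 c x) y) z) \<in> bilinear_forms s2 W s3 U"
      by (rule 1, rule V.subspace_scale[OF V(2)]) fact
    show ?thesis using that(2)
      by (induction rule: tensor_induct)
        (use sc that(1) 1 in \<open>auto simp: tens_def[of s2 W s3 U] tens_bilinear
          tens_in_tensor_space bilinear_formsD[OF b] algebra_simps\<close>)
  qed
  show "(\<lambda>x r. r (\<lambda>y z. b (tens s1 V s2 W x y) z))
      \<in> bilinear_forms s1 V fun_scale (tensor_space s2 W s3 U)"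
    by (rule bilinear_formsI) (use 2 3 in auto)
qed

lemma tensor_assoc_tens:
  assumes "vector_space s1" "module.subspace s1 V" "x \<in> V"
  shows "tensor_assoc s1 V s2 W s3 U
      (tens s1 V fun_scale (tensor_space s2 W s3 U) x (tens s2 W s3 U y z))
    = tens fun_scale (tensor_space s1 V s2 W) s3 U (tens s1 V s2 W x y) z"
  using tensor_assoc_form[OF assms(1,2), of _ s2 W s3 U] assms(3)
  by (auto simp: tensor_assoc_def tens_def[of s1 V fun_scale] tens_def[of s2 W s3 U]
      tens_def[of fun_scale] fun_eq_iff)

lemma tensor_assoc_linear:
  "tensor_assoc s1 V s2 W s3 U (t + u) =
     tensor_assoc s1 V s2 W s3 U t + tensor_assoc s1 V s2 W s3 U u"
  "tensor_assoc s1 V s2 W s3 U (fun_scale c t) = fun_scale c (tensor_assoc s1 V s2 W s3 U t)"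
  by (auto simp: tensor_assoc_def fun_eq_iff)

lemma product_form:
  assumes "f \<in> dual_space s1 V" "g \<in> dual_space s2 W"
  shows "(\<lambda>x y. f x * g y) \<in> bilinear_forms s1 V s2 W"
  by (rule bilinear_formsI)
    (use assms in \<open>auto simp: dual_space_def linear_on_def algebra_simps\<close>)

lemma canonical_embedding_form:
  assumes "D \<subseteq> dual_space s1 V" "E \<subseteq> dual_space s2 W" "u \<in> tensor_space s1 V s2 W"
  shows "(\<lambda>f g. u (\<lambda>x y. f x * g y)) \<in> bilinear_forms fun_scale D fun_scale E"
proof -
  have p: "f \<in> D \<Longrightarrow> g \<in> E \<Longrightarrow> (\<lambda>x y. f x * g y) \<in> bilinear_forms s1 V s2 W" for f g
    using product_form assms(1,2) by blast
  note add = tensor_forms_add[OF assms(3) p p] and scale = tensor_forms_scale[OF assms(3) p]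
  show ?thesis
  proof (rule bilinear_formsI)
    fix f f' g assume "f \<in> D" "f' \<in> D" "g \<in> E"
    then show "u (\<lambda>x y. (f + f') x * g y) = u (\<lambda>x y. f x * g y) + u (\<lambda>x y. f' x * g y)"
      using add[of f g f' g] by (simp add: algebra_simps)
  next
    fix c f g assume "f \<in> D" "g \<in> E"
    then show "u (\<lambda>x y. fun_scale c f x * g y) = c * u (\<lambda>x y. f x * g y)"
      using scale[of f g c] by (simp add: algebra_simps)
  next
    fix f g g' assume "f \<in> D" "g \<in> E" "g' \<in> E"
    then show "u (\<lambda>x y. f x * (g + g') y) = u (\<lambda>x y. f x * g y) + u (\<lambda>x y. f x * g' y)"
      using add[of f g f g'] by (simp add: algebra_simps)
  next
    fix c f g assume "f \<in> D" "g \<in> E"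
    then show "u (\<lambda>x y. f x * fun_scale c g y) = c * u (\<lambda>x y. f x * g y)"
      using scale[of f g c] by (simp add: algebra_simps)
  qed
qed

lemma canonical_embedding_tens:
  assumes "D \<subseteq> dual_space s1 V" "E \<subseteq> dual_space s2 W"
    and "f \<in> D" "g \<in> E" "x \<in> V" "y \<in> W"
  shows "canonical_embedding s1 V s2 W (tens fun_scale D fun_scale E f g) (tens s1 V s2 W x y)
    = f x * g y"
proof -
  let ?u = "tens s1 V s2 W x y"
  have u: "?u \<in> tensor_space s1 V s2 W" using assms(5,6) by (rule tens_in_tensor_space)
  have "?u (\<lambda>x y. f x * g y) = f x * g y"
    using product_form[of f s1 V g s2 W] assms(1-4) by (auto simp: tens_def)
  with canonical_embedding_form[OF assms(1,2) u] u show ?thesis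
    by (simp add: canonical_embedding_def tens_def[of fun_scale D])
qed

lemma canonical_embedding_linear:
  "canonical_embedding s1 V s2 W (t + u) =
     canonical_embedding s1 V s2 W t + canonical_embedding s1 V s2 W u"
  "canonical_embedding s1 V s2 W (fun_scale c t) = fun_scale c (canonical_embedding s1 V s2 W t)"
  by (auto simp: canonical_embedding_def fun_eq_iff)

theorem inj_on_canonical_embedding:
  fixes s1 :: "'k::field \<Rightarrow> 'a::ab_group_add \<Rightarrow> 'a" and s2 :: "'k \<Rightarrow> 'b::ab_group_add \<Rightarrow> 'b"
  assumes D: "fun_vs.subspace D" "D \<subseteq> dual_space s1 V"
    and E: "fun_vs.subspace E" "E \<subseteq> dual_space s2 W"
  shows "inj_on (canonical_embedding s1 V s2 W) (tensor_space fun_scale D fun_scale E)"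
proof -
  note [simp del] = fun_scale_apply plus_fun_apply zero_fun_apply
  note app_simps = fun_scale_apply plus_fun_apply zero_fun_apply
  let ?T = "tensor_space fun_scale D fun_scale E" and ?t = "tens fun_scale D fun_scale E"
  let ?i = "canonical_embedding s1 V s2 W"
  obtain B where B: "B \<subseteq> E" "fun_vs.independent B" "E \<subseteq> fun_vs.span B"
    using fun_vs.maximal_independent_subset[of E] by blast
  have tr: "?t f (\<Sum>e\<in>S. fun_scale (c e) e) = (\<Sum>e\<in>S. ?t (fun_scale (c e) f) e)"
    if "finite S" "S \<subseteq> B" "f \<in> D" for S c f
    using that
  proof (induction S rule: finite_induct)
    case empty
    have "(0 :: 'b \<Rightarrow> 'k) \<in> E" by (rule fun_vs.subspace_0[OF E(1)])
    then have "?t f (fun_scale 0 0) = fun_scale 0 (?t f 0)"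
      using empty by (intro tens_bilinear) auto
    then show ?case by (simp only: fun_vs.scale_zero_left sum.empty)
  next
    case (insert e S)
    then have "e \<in> E" "(\<Sum>e\<in>S. fun_scale (c e) e) \<in> E" "fun_scale (c e) e \<in> E"
      using B(1) by (auto intro!: fun_vs.subspace_sum[OF E(1)] fun_vs.subspace_scale[OF E(1)])
    then have "?t f (fun_scale (c e) e + (\<Sum>e\<in>S. fun_scale (c e) e)) =
      ?t (fun_scale (c e) f) e + ?t f (\<Sum>e\<in>S. fun_scale (c e) e)"
      using insert.prems by (simp add: tens_bilinear)
    with insert show ?case by (simp only: sum.insert simp_thms insert_subset)
  qed
  have repr: "\<exists>S h. finite S \<and> S \<subseteq> B \<and> (\<forall>e. h e \<in> D) \<and> t = (\<Sum>e\<in>S. ?t (h e) e)"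
    if "t \<in> ?T" for t
    using that
  proof (induction rule: tensor_induct)
    case zero
    show ?case
      by (rule exI[of _ "{}"], rule exI[of _ "\<lambda>_. 0"])
        (simp only: fun_vs.subspace_0[OF D(1)] sum.empty finite.emptyI empty_subsetI simp_thms)
  next
    case (tens f g)
    then have "g \<in> fun_vs.span B" using B by blast
    then obtain S c where "finite S" "S \<subseteq> B" "g = (\<Sum>e\<in>S. fun_scale (c e) e)"
      by (auto simp: fun_vs.span_explicit)
    with tens show ?case using tr[of S f c] fun_vs.subspace_scale[OF D(1)]
      by (intro exI[of _ S] exI[of _ "\<lambda>e. fun_scale (c e) f"]) auto
  next
    case (add t u)
    obtain S h where *: "finite S" "S \<subseteq> B" "\<forall>e. h e \<in> D" "t = (\<Sum>e\<in>S. ?t (h e) e)"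
      using add(3) by (elim exE conjE) (rule that)
    obtain S' h' where **: "finite S'" "S' \<subseteq> B" "\<forall>e. h' e \<in> D" "u = (\<Sum>e\<in>S'. ?t (h' e) e)"
      using add(4) by (elim exE conjE) (rule that)
    define k where "k e = (if e \<in> S then h e else 0)" for e
    define k' where "k' e = (if e \<in> S' then h' e else 0)" for e
    have k: "k e \<in> D" "k' e \<in> D" for e
      using * ** fun_vs.subspace_0[OF D(1)] by (auto simp: k_def k'_def)
    have z: "?t 0 e = 0" if "e \<in> B" for e
    proof -
      have "?t (fun_scale 0 0) e = fun_scale 0 (?t 0 e)"
        using that B fun_vs.subspace_0[OF D(1)] by (intro tens_bilinear) auto
      then show ?thesis by simp
    qed
    have "t = (\<Sum>e\<in>S \<union> S'. ?t (k e) e)" unfolding *(4)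
      by (rule sum.mono_neutral_cong_left) (use * ** z in \<open>auto simp: k_def\<close>)
    moreover have "u = (\<Sum>e\<in>S \<union> S'. ?t (k' e) e)" unfolding **(4)
      by (rule sum.mono_neutral_cong_left) (use * ** z in \<open>auto simp: k'_def\<close>)
    moreover have "(\<Sum>e\<in>S \<union> S'. ?t (k e + k' e) e) = (\<Sum>e\<in>S \<union> S'. ?t (k e) e + ?t (k' e) e)"
      by (rule sum.cong) (use k * ** B in \<open>auto intro!: tens_bilinear\<close>)
    ultimately have "t + u = (\<Sum>e\<in>S \<union> S'. ?t (k e + k' e) e)" by (simp add: sum.distrib)
    with * ** k show ?case using fun_vs.subspace_add[OF D(1)]
      by (intro exI[of _ "S \<union> S'"] exI[of _ "\<lambda>e. k e + k' e"]) auto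
  next
    case (scale c t)
    from scale(2) obtain S h where
      *: "finite S" "S \<subseteq> B" "\<forall>e. h e \<in> D" "t = (\<Sum>e\<in>S. ?t (h e) e)"
      by (elim exE conjE) (rule that)
    have "(\<Sum>e\<in>S. ?t (fun_scale c (h e)) e) = (\<Sum>e\<in>S. fun_scale c (?t (h e) e))"
      by (rule sum.cong) (use * B in \<open>auto intro!: tens_bilinear\<close>)
    then have "fun_scale c t = (\<Sum>e\<in>S. ?t (fun_scale c (h e)) e)"
      by (simp add: *(4) fun_vs.scale_sum_right)
    with * show ?case using fun_vs.subspace_scale[OF D(1)]
      by (intro exI[of _ S] exI[of _ "\<lambda>e. fun_scale c (h e)"]) auto
  qed
  have inj0: "t = 0" if t: "t \<in> ?T" and i: "?i t = 0" for t
  proof -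
    obtain S h where *: "finite S" "S \<subseteq> B" "\<forall>e. h e \<in> D" "t = (\<Sum>e\<in>S. ?t (h e) e)"
      using repr[OF t] by (elim exE conjE) (rule that)
    have i_sum: "?i (\<Sum>e\<in>R. ?t (h e) e) = (\<Sum>e\<in>R. ?i (?t (h e) e))" for R
    proof -
      have i_zero: "?i 0 = 0" by (auto simp: canonical_embedding_def fun_eq_iff app_simps)
      show ?thesis
        by (induction R rule: infinite_finite_induct) (simp_all add: i_zero canonical_embedding_linear)
    qed
    have ev: "(\<Sum>e\<in>S. h e x * e y) = 0" if xy: "x \<in> V" "y \<in> W" for x y
    proof -
      have app: "(\<Sum>e\<in>R. ?i (?t (h e) e)) v = (\<Sum>e\<in>R. ?i (?t (h e) e) v)" for R v
        by (induction R rule: infinite_finite_induct) (simp_all add: app_simps)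
      have "(\<Sum>e\<in>S. h e x * e y) = (\<Sum>e\<in>S. ?i (?t (h e) e) (tens s1 V s2 W x y))"
        by (rule sum.cong)
          (use * B xy canonical_embedding_tens[OF D(2) E(2)] in auto)
      also have "\<dots> = ?i t (tens s1 V s2 W x y)" unfolding *(4) i_sum app ..
      finally show ?thesis using i by (simp add: app_simps)
    qed
    have h0: "h e = 0" if "e \<in> S" for e
    proof
      fix x
      show "h e x = 0 x"
      proof (cases "x \<in> V")
        case True
        have app: "(\<Sum>e\<in>R. fun_scale (h e x) e) y = (\<Sum>e\<in>R. h e x * e y)" for R y
          by (induction R rule: infinite_finite_induct) (simp_all add: app_simps)
        have "(\<Sum>e\<in>S. fun_scale (h e x) e) = 0"
        proof
          fix y
          show "(\<Sum>e\<in>S. fun_scale (h e x) e) y = 0 y"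
          proof (cases "y \<in> W")
            case True
            with ev \<open>x \<in> V\<close> show ?thesis by (simp add: app app_simps)
          next
            case False
            then have "e y = 0" if "e \<in> S" for e
              using that * B E(2) by (auto simp: dual_space_def subset_iff)
            then have "(\<Sum>e\<in>S. h e x * e y) = 0" by (intro sum.neutral) simp
            then show ?thesis by (simp add: app app_simps)
          qed
        qed
        with fun_vs.independentD[OF B(2) *(1,2)] that show ?thesis by (auto simp: app_simps)
      next
        case False
        with *(3) D(2) show ?thesis by (auto simp: app_simps dual_space_def subset_iff)
      qed
    qed
    have "?t 0 e = 0" if "e \<in> S" for e
    proof -
      have "?t (fun_scale 0 0) e = fun_scale 0 (?t 0 e)"
        using that * B fun_vs.subspace_0[OF D(1)] by (intro tens_bilinear) auto
      then show ?thesis by simp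
    qed
    then show "t = 0" unfolding *(4) by (intro sum.neutral) (auto simp: h0)
  qed
  show ?thesis
  proof (rule inj_onI)
    fix t u assume tu: "t \<in> ?T" "u \<in> ?T" "?i t = ?i u"
    have "t - u \<in> ?T" using tu by (intro fun_vs.subspace_diff[OF subspace_tensor_space])
    moreover have "?i (t - u) = 0"
      using tu(3) by (auto simp: canonical_embedding_def fun_eq_iff app_simps split: if_splits)
    ultimately show "t = u" using inj0 by fastforce
  qed
qed

end

theory Submission
  imports Defs
begin

text \<open>
  A functional \<open>f\<close> that vanishes on a finite-codimensional ideal \<open>J\<close> factors through \<open>G/J\<close>, so
  \<open>f \<circ> \<mu>\<close> is a finite sum of products of functionals vanishing on \<open>J\<close>.  Evaluation at elements of
  \<open>G\<close> separates the points of \<open>G\<^sup>\<circ> \<otimes> G\<^sup>\<circ>\<close> and of \<open>(G\<^sup>\<circ> \<otimes> G\<^sup>\<circ>) \<otimes> G\<^sup>\<circ>\<close>, and turns each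
  coalgebra axiom into the corresponding axiom of \<open>G\<close>.
\<close>

section \<open>Separation of tensors over dual spaces\<close>

text \<open>These forms are the test points used throughout: a tensor applied to one of them is its
  value at the pair \<open>x\<close>, \<open>y\<close>.\<close>

lemma product_form_eval:
  "(\<lambda>f g. f x * g y) \<in> bilinear_forms fun_scale D fun_scale E"
  by (rule bilinear_formsI) (auto simp: algebra_simps)

lemma tensor_forms_zero:
  assumes "t \<in> tensor_space s1 V s2 W"
  shows "t (\<lambda>x y. 0) = 0"
proof -
  have "(\<lambda>x y. 0) \<in> bilinear_forms s1 V s2 W" by (rule bilinear_formsI) auto
  from tensor_forms_scale[OF assms this, of 0] show ?thesis by simp
qed

lemma tensor_outside_forms:
  assumes "t \<in> tensor_space s1 V s2 W" "b \<notin> bilinear_forms s1 V s2 W"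
  shows "t b = 0"
  using assms(1) by (induction rule: tensor_induct) (use assms(2) in \<open>auto simp: tens_def\<close>)

text \<open>Makes a tensor space admissible as the factor \<open>D\<close> in
  \<open>tensor_dual_eqI\<close>, the vectors now being bilinear forms. Scaling is written out since
  \<open>fun_scale\<close> does not act on curried functions of two arguments.\<close>

lemma tensor_space_subset_dual:
  "tensor_space s1 V s2 W \<subseteq> dual_space (\<lambda>c b x y. c * b x y) (bilinear_forms s1 V s2 W)"
proof
  fix t assume t: "t \<in> tensor_space s1 V s2 W"
  have "t (b + b') = t b + t b'"
    if "b \<in> bilinear_forms s1 V s2 W" "b' \<in> bilinear_forms s1 V s2 W" for b b'
    using tensor_forms_add[OF t that] by (simp add: plus_fun_def)
  with t show "t \<in> dual_space (\<lambda>c b x y. c * b x y) (bilinear_forms s1 V s2 W)"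
    by (auto simp: dual_space_def linear_on_def tensor_forms_scale tensor_outside_forms)
qed

text \<open>By injectivity of the canonical embedding it suffices to compare both images at each
  \<open>w\<close> in the tensor product of \<open>V\<close> and \<open>W\<close>. Both are linear
  in \<open>w\<close>, so pure tensors suffice, and there the comparison is
  \<open>eq\<close>.\<close>

lemma tensor_dual_eqI:
  assumes D: "fun_vs.subspace D" "D \<subseteq> dual_space s1 V"
    and E: "fun_vs.subspace E" "E \<subseteq> dual_space s2 W"
    and t: "t \<in> tensor_space fun_scale D fun_scale E"
    and u: "u \<in> tensor_space fun_scale D fun_scale E"
    and eq: "\<And>x y. x \<in> V \<Longrightarrow> y \<in> W \<Longrightarrow> t (\<lambda>f g. f x * g y) = u (\<lambda>f g. f x * g y)"
  shows "t = u"
proof -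
  note form = canonical_embedding_form[OF D(2) E(2)]
  have "t (\<lambda>f g. w (\<lambda>x y. f x * g y)) = u (\<lambda>f g. w (\<lambda>x y. f x * g y))"
    if "w \<in> tensor_space s1 V s2 W" for w
    using that
  proof (induction rule: tensor_induct)
    case zero
    show ?case by (simp add: tensor_forms_zero[OF t] tensor_forms_zero[OF u])
  next
    case (tens x y)
    have ev: "tens s1 V s2 W x y (\<lambda>x y. f x * g y) = f x * g y" if "f \<in> D" "g \<in> E" for f g
      using product_form[of f s1 V g s2 W] that D(2) E(2) by (auto simp: tens_def)
    \<comment> \<open>The two bilinear forms are known to agree only for \<open>f\<close> in
      \<open>D\<close> and \<open>g\<close> in \<open>E\<close>, which is enough for a tensor by
      \<open>tensor_forms_cong\<close>.\<close>
    have "v (\<lambda>f g. tens s1 V s2 W x y (\<lambda>x y. f x * g y)) = v (\<lambda>f g. f x * g y)"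
      if "v \<in> tensor_space fun_scale D fun_scale E" for v
      by (rule tensor_forms_cong[OF that form[OF tens_in_tensor_space[OF tens]] product_form_eval ev])
    from this[OF t] this[OF u] eq[OF tens] show ?case by simp
  next
    case (add w w')
    then show ?case
      by (simp add: tensor_forms_add[OF t form form] tensor_forms_add[OF u form form])
  next
    case (scale c w)
    then show ?case
      by (simp add: tensor_forms_scale[OF t form] tensor_forms_scale[OF u form])
  qed
  \<comment> \<open>Outside the tensor space both embeddings are 0 by definition.\<close>
  then have "canonical_embedding s1 V s2 W t = canonical_embedding s1 V s2 W u"
    by (auto simp: canonical_embedding_def fun_eq_iff)
  with t u show ?thesis by (rule inj_onD[OF inj_on_canonical_embedding[OF D E], rotated])
qed

text \<open>Evaluating the right factor at \<open>z\<close> sends \<open>p\<close> tensor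
  \<open>h\<close> to \<open>h z\<close> times \<open>p\<close>; this reduces three factors to
  two.\<close>

lemma tensor_contract_right:
  assumes "t \<in> tensor_space fun_scale (tensor_space s1 V s2 W) fun_scale E"
  shows "(\<lambda>b. t (\<lambda>p h. p b * h z)) \<in> tensor_space s1 V s2 W"
  using assms
proof (induction rule: tensor_induct)
  case zero
  show ?case using fun_vs.subspace_0[OF subspace_tensor_space] by (simp add: zero_fun_def)
next
  case (tens p h)
  have "(\<lambda>b. tens fun_scale (tensor_space s1 V s2 W) fun_scale E p h (\<lambda>p h. p b * h z))
      = fun_scale (h z) p"
    by (auto simp: tens_def product_form_eval fun_eq_iff)
  with tens show ?case by (simp add: fun_vs.subspace_scale[OF subspace_tensor_space])
next
  case (add t u)
  from fun_vs.subspace_add[OF subspace_tensor_space add(3,4)] show ?case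
    by (simp add: plus_fun_def)
next
  case (scale c t)
  from fun_vs.subspace_scale[OF subspace_tensor_space scale(2), of c] show ?case
    by (simp add: fun_scale_def)
qed

text \<open>A tensor \<open>p \<in> D \<otimes> E\<close> is itself a functional, on the bilinear forms on \<open>D \<times> E\<close>, so
  two applications of \<open>tensor_dual_eqI\<close> separate the points of \<open>(D \<otimes> E) \<otimes> F\<close>.\<close>

lemma tensor_dual_eqI3:
  assumes D: "fun_vs.subspace D" "D \<subseteq> dual_space s1 V"
    and E: "fun_vs.subspace E" "E \<subseteq> dual_space s2 W"
    and F: "fun_vs.subspace F" "F \<subseteq> dual_space s3 U"
    and t: "t \<in> tensor_space fun_scale (tensor_space fun_scale D fun_scale E) fun_scale F"
    and u: "u \<in> tensor_space fun_scale (tensor_space fun_scale D fun_scale E) fun_scale F"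
    and eq: "\<And>x y z. x \<in> V \<Longrightarrow> y \<in> W \<Longrightarrow> z \<in> U \<Longrightarrow>
      t (\<lambda>p h. p (\<lambda>f g. f x * g y) * h z) = u (\<lambda>p h. p (\<lambda>f g. f x * g y) * h z)"
  shows "t = u"
proof (rule tensor_dual_eqI[OF subspace_tensor_space tensor_space_subset_dual F t u])
  fix b z assume "z \<in> U"
  \<comment> \<open>The contractions at \<open>z\<close> are tensors over \<open>D\<close> and
    \<open>E\<close> that agree at all test points, hence equal as functions. This gives the value
    at every \<open>b\<close>.\<close>
  with eq have "(\<lambda>b. t (\<lambda>p h. p b * h z)) = (\<lambda>b. u (\<lambda>p h. p b * h z))"
    by (intro tensor_dual_eqI[OF D E] tensor_contract_right[OF t] tensor_contract_right[OF u])
  then show "t (\<lambda>p h. p b * h z) = u (\<lambda>p h. p b * h z)" by (rule fun_cong)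
qed

text \<open>A generator \<open>x\<close> tensor \<open>r\<close> still contains a general tensor
  \<open>r\<close>, so a second induction on \<open>r\<close> is nested inside the first.\<close>

lemma tensor_assoc_in_tensor_space:
  assumes V: "vector_space s1" "module.subspace s1 V"
    and t: "t \<in> tensor_space s1 V fun_scale (tensor_space s2 W s3 U)"
  shows "tensor_assoc s1 V s2 W s3 U t \<in> tensor_space fun_scale (tensor_space s1 V s2 W) s3 U"
proof -
  let ?T = "tensor_space fun_scale (tensor_space s1 V s2 W) s3 U"
  let ?a = "tensor_assoc s1 V s2 W s3 U"
  let ?t = "tens s1 V fun_scale (tensor_space s2 W s3 U)"
  have a0: "?a 0 \<in> ?T"
    using fun_vs.subspace_0[OF subspace_tensor_space] tensor_assoc_linear(2)[of s1 V s2 W s3 U 0 0]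
    by simp
  note closed = fun_vs.subspace_add[OF subspace_tensor_space]
    fun_vs.subspace_scale[OF subspace_tensor_space]
  from t show ?thesis
  proof (induction rule: tensor_induct)
    case (tens x r)
    from tens(2) show ?case
    proof (induction rule: tensor_induct)
      case zero
      have "?t x (fun_scale 0 0) = fun_scale 0 (?t x 0)"
        using tens(1) by (intro tens_bilinear fun_vs.subspace_0[OF subspace_tensor_space])
      then have "?t x 0 = 0" by (simp only: fun_vs.scale_zero_left)
      with a0 show ?case by (simp only:)
    next
      case (tens y z)
      with \<open>x \<in> V\<close> show ?case by (simp only: tensor_assoc_tens[OF V] tens_in_tensor_space)
    next
      case (add r r')
      with \<open>x \<in> V\<close> show ?case by (simp only: tens_bilinear tensor_assoc_linear closed)
    next
      case (scale c r)
      with \<open>x \<in> V\<close> show ?case by (simp only: tens_bilinear tensor_assoc_linear closed)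
    qed
  qed (simp_all only: a0 tensor_assoc_linear closed)
qed

section \<open>Subspaces of finite codimension\<close>

context vector_space
begin

lemma linear_on_functional_iff:
  "linear_on scale UNIV (*) UNIV f \<longleftrightarrow> (\<forall>x y. f (x + y) = f x + f y) \<and> (\<forall>c x. f (scale c x) = c * f x)"
  by (auto simp: linear_on_def)

text \<open>A basis \<open>K\<close> of \<open>J\<close> is extended by vectors of \<open>B\<close>
  to a basis \<open>L\<close> of the whole space. Then \<open>I\<close> is \<open>L - K\<close>, and
  \<open>e i\<close> is the coordinate along \<open>i\<close>.\<close>

lemma finite_complement_coordinates:
  assumes J: "subspace J" and B: "finite B" "\<And>x. \<exists>y\<in>span B. x - y \<in> J"
  obtains I e where "finite I"
    "\<And>i. i \<in> I \<Longrightarrow> e i \<in> dual_space scale UNIV"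
    "\<And>i x. i \<in> I \<Longrightarrow> x \<in> J \<Longrightarrow> e i x = 0"
    "\<And>x. x - (\<Sum>i\<in>I. scale (e i x) i) \<in> J"
proof -
  obtain K where K: "K \<subseteq> J" "independent K" "J \<subseteq> span K"
    using maximal_independent_subset[of J] by blast
  obtain L where L: "K \<subseteq> L" "L \<subseteq> K \<union> B" "independent L" "K \<union> B \<subseteq> span L"
    using maximal_independent_subset_extend[of K "K \<union> B"] K(2) by blast
  have spanK: "span K = J" using K J by (simp add: span_subspace)
  have KL: "span K \<subseteq> span L" "span B \<subseteq> span L" using L by (simp_all add: span_minimal span_mono)
  have x: "x \<in> span L" for x
  proof -
    obtain y where "y \<in> span B" "x - y \<in> J" using B(2) by blast
    with KL spanK have "(x - y) + y \<in> span L" by (intro span_add) auto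
    then show ?thesis by simp
  qed
  let ?e = "\<lambda>i x. representation L x i"
  show ?thesis
  proof (rule that[of "L - K" ?e])
    show "finite (L - K)" using L(2) B(1) by (auto intro: finite_subset)
    show "?e i \<in> dual_space scale UNIV" for i
      using L(3) x by (simp add: dual_space_def linear_on_functional_iff representation_add representation_scale)
    \<comment> \<open>Vectors of \<open>J\<close> have the same coordinates in \<open>K\<close> as
      in \<open>L\<close>, hence none along a vector outside \<open>K\<close>.\<close>
    show "?e i y = 0" if "i \<in> L - K" "y \<in> J" for i y
    proof -
      have "representation L y = representation K y"
        using L that spanK by (intro representation_extend) auto
      with that show ?thesis using representation_ne_zero[of K y i] by auto
    qed
    show "y - (\<Sum>i\<in>L - K. scale (?e i y) i) \<in> J" for y
    proof -
      \<comment> \<open>The nonzero coordinates split into those along \<open>K\<close>, which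
        contribute a vector of \<open>J\<close>, and those along \<open>L - K\<close>.\<close>
      let ?S = "{i. ?e i y \<noteq> 0}"
      have fin: "finite ?S" by (rule finite_representation)
      have sub: "?S \<subseteq> L" using representation_ne_zero by blast
      have "y = (\<Sum>i\<in>?S. scale (?e i y) i)"
        using sum_nonzero_representation_eq[OF L(3) x] by simp
      also have "\<dots> = (\<Sum>i\<in>?S \<inter> K. scale (?e i y) i) + (\<Sum>i\<in>?S - K. scale (?e i y) i)"
        using fin by (simp add: sum.Int_Diff)
      also have "(\<Sum>i\<in>?S - K. scale (?e i y) i) = (\<Sum>i\<in>L - K. scale (?e i y) i)"
        using \<open>finite (L - K)\<close> sub by (intro sum.mono_neutral_left) auto
      finally have "y - (\<Sum>i\<in>L - K. scale (?e i y) i) = (\<Sum>i\<in>?S \<inter> K. scale (?e i y) i)"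
        by (simp add: algebra_simps)
      also have "\<dots> \<in> J" using K(1) by (intro subspace_sum[OF J] subspace_scale[OF J]) auto
      finally show ?thesis .
    qed
  qed
qed

text \<open>If \<open>f\<close> is nonzero on \<open>J\<close>, one vector \<open>p\<close> of
  \<open>J\<close> with \<open>f p\<close> nonzero is added to \<open>B\<close>; it corrects the
  value of \<open>f\<close> without leaving \<open>J\<close>.\<close>

lemma finite_complement_kernel:
  assumes "\<exists>B. finite B \<and> (\<forall>x. \<exists>y\<in>span B. x - y \<in> J)" and J: "subspace J"
    and f: "f \<in> dual_space scale UNIV"
  shows "\<exists>B. finite B \<and> (\<forall>x. \<exists>y\<in>span B. x - y \<in> J \<and> f (x - y) = 0)"
proof (cases "\<forall>x\<in>J. f x = 0")
  case True
  then have "x \<in> J \<and> f x = 0 \<longleftrightarrow> x \<in> J" for x by blast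
  with assms(1) show ?thesis by simp
next
  case False
  from assms(1) obtain B where B: "finite B" "\<forall>x. \<exists>y\<in>span B. x - y \<in> J" by blast
  from False obtain p where p: "p \<in> J" "f p \<noteq> 0" by blast
  have lin: "f (x + y) = f x + f y" "f (scale c x) = c * f x" for c x y
    using f by (auto simp: dual_space_def linear_on_functional_iff)
  have "\<exists>y\<in>span (insert p B). x - y \<in> J \<and> f (x - y) = 0" for x
  proof -
    obtain y where y: "y \<in> span B" "x - y \<in> J" using B(2) by blast
    \<comment> \<open>The multiple of \<open>p\<close> whose value under \<open>f\<close> cancels
      \<open>f (x - y)\<close>.\<close>
    let ?q = "scale (- (f (x - y) / f p)) p"
    have "y \<in> span (insert p B)" using y(1) span_mono[of B "insert p B"] by blast
    then have "y - ?q \<in> span (insert p B)"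
      by (rule span_diff) (intro span_scale span_base insertI1)
    moreover have "(x - y) + ?q \<in> J"
      using y p by (intro subspace_add[OF J] subspace_scale[OF J])
    moreover have "f ((x - y) + ?q) = 0" unfolding lin using p(2) by simp
    moreover have "(x - y) + ?q = x - (y - ?q)" by simp
    ultimately show ?thesis by (intro bexI[of _ "y - ?q"]) (simp_all only: simp_thms)
  qed
  with B(1) show ?thesis by (intro exI[of _ "insert p B"]) simp
qed

text \<open>Coordinates modulo \<open>K\<close> are finitely many functionals whose common kernel
  lies in \<open>K\<close>. Cutting \<open>J\<close> by them one at a time keeps the codimension
  finite, and the result sits inside the intersection.\<close>

lemma finite_complement_Int:
  assumes J: "subspace J" "\<exists>B. finite B \<and> (\<forall>x. \<exists>y\<in>span B. x - y \<in> J)"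
    and K: "subspace K" "\<exists>B. finite B \<and> (\<forall>x. \<exists>y\<in>span B. x - y \<in> K)"
  shows "\<exists>B. finite B \<and> (\<forall>x. \<exists>y\<in>span B. x - y \<in> J \<inter> K)"
proof -
  from K(2) obtain C where C: "finite C" "\<And>x. \<exists>y\<in>span C. x - y \<in> K" by blast
  from K(1) C obtain I e where I: "finite I" "\<And>i. i \<in> I \<Longrightarrow> e i \<in> dual_space scale UNIV"
    "\<And>i x. i \<in> I \<Longrightarrow> x \<in> K \<Longrightarrow> e i x = 0"
    "\<And>x. x - (\<Sum>i\<in>I. scale (e i x) i) \<in> K"
    by (rule finite_complement_coordinates) blast
  \<comment> \<open>The subspace property is carried along because each application of
    \<open>finite_complement_kernel\<close> requires it.\<close>
  have "subspace {x \<in> J. \<forall>i\<in>S. e i x = 0} \<and>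
      (\<exists>B. finite B \<and> (\<forall>x. \<exists>y\<in>span B. x - y \<in> {x \<in> J. \<forall>i\<in>S. e i x = 0}))"
    if "finite S" "S \<subseteq> I" for S
    using that
  proof (induction S rule: finite_induct)
    case empty
    then show ?case using J by simp
  next
    case (insert i S)
    let ?J = "{x \<in> J. \<forall>i\<in>S. e i x = 0}"
    from insert have i: "e i \<in> dual_space scale UNIV" using I(2) by blast
    then have lin: "e i (x + y) = e i x + e i y" "e i (scale c x) = c * e i x" for c x y
      by (auto simp: dual_space_def linear_on_functional_iff)
    have "subspace {x. e i x = 0}"
      using lin(2)[of 0 0] by (intro subspaceI) (simp_all add: lin)
    moreover have "{x \<in> J. \<forall>i\<in>insert i S. e i x = 0} = ?J \<inter> {x. e i x = 0}" by auto
    ultimately show ?case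
      using insert finite_complement_kernel[of ?J, OF _ _ i] by (simp add: subspace_inter)
  qed
  from this[OF I(1)] obtain B where B: "finite B"
    "\<And>x. \<exists>y\<in>span B. x - y \<in> {x \<in> J. \<forall>i\<in>I. e i x = 0}" by blast
  \<comment> \<open>With all coordinates zero the sum in \<open>I(4)\<close> vanishes, leaving
    \<open>x\<close> itself in \<open>K\<close>.\<close>
  have K0: "x \<in> K" if "\<forall>i\<in>I. e i x = 0" for x using I(4)[of x] that by simp
  have "\<exists>y\<in>span B. x - y \<in> J \<inter> K" for x
  proof -
    obtain y where "y \<in> span B" "x - y \<in> J" "\<forall>i\<in>I. e i (x - y) = 0" using B(2)[of x] by auto
    with K0 show ?thesis by blast
  qed
  with B(1) show ?thesis by blast
qed

end

section \<open>The Sweedler dual\<close>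

context bihom_algebra
begin

abbreviation times_G :: "'g \<Rightarrow> 'g \<Rightarrow> 'g" (infixl "\<cdot>" 70) where
  "x \<cdot> y \<equiv> \<mu> (tens scale UNIV scale UNIV x y)"

lemma mult_linear:
  "(x + x') \<cdot> y = x \<cdot> y + x' \<cdot> y" "scale c x \<cdot> y = scale c (x \<cdot> y)"
  "x \<cdot> (y + y') = x \<cdot> y + x \<cdot> y'" "x \<cdot> scale c y = scale c (x \<cdot> y)"
  by (simp_all add: tens_bilinear linear_onD[OF linear_\<mu>] tens_in_tensor_space)

text \<open>Two classes coincide exactly when their representatives differ by an element of
  \<open>J\<close>, so covering the quotient by classes from \<open>span B\<close> means
  approximating every \<open>x\<close> modulo \<open>J\<close>.\<close>

lemma finite_codimensional_iff:
  assumes "subspace J"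
  shows "finite_codimensional J \<longleftrightarrow> (\<exists>B. finite B \<and> (\<forall>x. \<exists>y\<in>span B. x - y \<in> J))"
proof -
  define cl where "cl x = {(x, y). x - y \<in> J} `` {x}" for x
  have mem: "z \<in> cl x \<longleftrightarrow> x - z \<in> J" for x z by (simp add: cl_def)
  have cl_eq: "cl x = cl y \<longleftrightarrow> x - y \<in> J" for x y
  proof
    assume "cl x = cl y"
    then have "y \<in> cl x \<longleftrightarrow> y \<in> cl y" by (rule arg_cong)
    with subspace_0[OF assms] show "x - y \<in> J" by (simp add: mem)
  next
    assume xy: "x - y \<in> J"
    have "x - z \<in> J \<longleftrightarrow> y - z \<in> J" for z
    proof
      assume "x - z \<in> J"
      from subspace_diff[OF assms this xy] show "y - z \<in> J" by simp
    next
      assume "y - z \<in> J"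
      from subspace_add[OF assms xy this] show "x - z \<in> J" by simp
    qed
    then show "cl x = cl y" by (simp add: set_eq_iff mem)
  qed
  have "UNIV // {(x, y). x - y \<in> J} = range cl"
    unfolding quotient_def cl_def by (rule UNION_singleton_eq_range)
  moreover have "cl ` S = range cl \<longleftrightarrow> (\<forall>x. \<exists>y\<in>S. cl x = cl y)" for S by blast
  ultimately show ?thesis unfolding finite_codimensional_def cl_def[symmetric] cl_eq by simp
qed

section \<open>Ideals and closure properties of the Sweedler dual\<close>

lemma ideal_subspace: "ideal J \<Longrightarrow> subspace J"
  by (simp add: ideal_def)

lemma ideal_Int: "ideal J \<Longrightarrow> ideal K \<Longrightarrow> ideal (J \<inter> K)"
  by (auto simp: ideal_def subspace_inter)

lemma ideal_UNIV: "ideal UNIV"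
  by (simp add: ideal_def)

lemma sweedler_dual_subset: "sweedler_dual \<subseteq> dual_space scale UNIV"
  by (auto simp: sweedler_dual_def)

lemma sweedler_dual_linear:
  assumes "f \<in> sweedler_dual"
  shows "f (x + y) = f x + f y" "f (scale c x) = c * f x"
  using assms by (auto simp: sweedler_dual_def dual_space_def linear_on_functional_iff)

lemma sweedler_dualI:
  assumes "f \<in> dual_space scale UNIV" "ideal J" "finite_codimensional J" "\<And>x. x \<in> J \<Longrightarrow> f x = 0"
  shows "f \<in> sweedler_dual"
  using assms by (auto simp: sweedler_dual_def)

lemma sweedler_dualE:
  assumes "f \<in> sweedler_dual"
  obtains J where "f \<in> dual_space scale UNIV" "ideal J" "finite_codimensional J"
    "\<And>x. x \<in> J \<Longrightarrow> f x = 0"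
  using assms by (auto simp: sweedler_dual_def)

text \<open>A sum vanishes on the intersection of the two ideals, of finite codimension by
  \<open>finite_complement_Int\<close>. A multiple keeps its ideal, and 0 takes the ideal
  \<open>UNIV\<close> with empty spanning set.\<close>

lemma subspace_sweedler_dual: "fun_vs.subspace sweedler_dual"
proof (rule fun_vs.subspaceI)
  have "finite_codimensional UNIV"
    by (auto simp: finite_codimensional_iff intro!: exI[of _ "{}"])
  then show "0 \<in> sweedler_dual"
    by (intro sweedler_dualI[OF _ ideal_UNIV])
      (auto simp: dual_space_def linear_on_functional_iff)
next
  fix f g assume "f \<in> sweedler_dual" "g \<in> sweedler_dual"
  then obtain J K where J: "f \<in> dual_space scale UNIV" "ideal J" "finite_codimensional J"
      "\<And>x. x \<in> J \<Longrightarrow> f x = 0"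
    and K: "g \<in> dual_space scale UNIV" "ideal K" "finite_codimensional K"
      "\<And>x. x \<in> K \<Longrightarrow> g x = 0"
    by (elim sweedler_dualE) blast
  have "finite_codimensional (J \<inter> K)"
    using finite_complement_Int[of J K] J(2,3) K(2,3)
    by (simp add: ideal_subspace finite_codimensional_iff subspace_inter)
  with J K show "f + g \<in> sweedler_dual"
    by (intro sweedler_dualI[OF _ ideal_Int[OF J(2) K(2)]])
      (auto simp: dual_space_def linear_on_functional_iff algebra_simps)
next
  fix c f assume "f \<in> sweedler_dual"
  then obtain J where "f \<in> dual_space scale UNIV" "ideal J" "finite_codimensional J"
    "\<And>x. x \<in> J \<Longrightarrow> f x = 0" by (elim sweedler_dualE) blast
  then show "fun_scale c f \<in> sweedler_dual"
    by (intro sweedler_dualI[of _ J])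
      (auto simp: dual_space_def linear_on_functional_iff algebra_simps)
qed

text \<open>The same ideal \<open>J\<close> serves, being stable under \<alpha> and \<beta>.\<close>

lemma star_sweedler_dual:
  assumes "f \<in> sweedler_dual"
  shows "alpha_star f \<in> sweedler_dual" "beta_star f \<in> sweedler_dual"
proof -
  obtain J where "f \<in> dual_space scale UNIV" "ideal J" "finite_codimensional J"
    "\<And>x. x \<in> J \<Longrightarrow> f x = 0" using assms by (elim sweedler_dualE) blast
  then show "alpha_star f \<in> sweedler_dual" "beta_star f \<in> sweedler_dual"
    using linear_\<alpha> linear_\<beta>
    by (intro sweedler_dualI[of _ J];
        auto simp: alpha_star_def beta_star_def dual_space_def linear_on_functional_iff
          ideal_def Vector_Spaces.linear_iff image_subset_iff)+
qed

lemma linear_on_star: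
  "linear_on fun_scale sweedler_dual fun_scale sweedler_dual alpha_star"
  "linear_on fun_scale sweedler_dual fun_scale sweedler_dual beta_star"
  by (auto simp: linear_on_def star_sweedler_dual) (auto simp: alpha_star_def beta_star_def fun_eq_iff)

text \<open>Again \<open>J\<close> is the witness, since it absorbs multiplication by
  \<open>a\<close>. These functionals are the right factors in the decomposition of
  \<open>mu_star f\<close>.\<close>

lemma sweedler_dual_translate:
  assumes "f \<in> dual_space scale UNIV" "ideal J" "finite_codimensional J" "\<And>x. x \<in> J \<Longrightarrow> f x = 0"
  shows "(\<lambda>y. f (a \<cdot> y)) \<in> sweedler_dual"
  by (rule sweedler_dualI[OF _ assms(2,3)])
    (use assms in \<open>auto simp: dual_space_def linear_on_functional_iff mult_linear ideal_def\<close>)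

section \<open>The comultiplication and its values\<close>

abbreviation "dual_tensor \<equiv> tensor_space fun_scale sweedler_dual fun_scale sweedler_dual"

abbreviation "embedding \<equiv> canonical_embedding scale UNIV scale UNIV"

text \<open>If \<open>x \<equiv> \<Sum>\<^sub>i e\<^sub>i(x) i\<close> modulo \<open>J\<close>, then \<open>f(x y) = \<Sum>\<^sub>i e\<^sub>i(x) f(i y)\<close>, where \<open>e\<^sub>i\<close> and
  \<open>f(i \<cdot> _)\<close> vanish on \<open>J\<close>.\<close>

lemma mu_star_in_embedding:
  assumes "f \<in> sweedler_dual"
  shows "mu_star f \<in> embedding ` dual_tensor"
proof -
  obtain J where J: "f \<in> dual_space scale UNIV" "ideal J" "finite_codimensional J"
    "\<And>x. x \<in> J \<Longrightarrow> f x = 0" using assms by (elim sweedler_dualE) blast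
  have sJ: "subspace J" using J(2) by (rule ideal_subspace)
  obtain B where B: "finite B" "\<And>x. \<exists>y\<in>span B. x - y \<in> J"
    using J(3) unfolding finite_codimensional_iff[OF sJ] by blast
  from sJ B obtain I e where I: "finite I" "\<And>i. i \<in> I \<Longrightarrow> e i \<in> dual_space scale UNIV"
    "\<And>i x. i \<in> I \<Longrightarrow> x \<in> J \<Longrightarrow> e i x = 0"
    "\<And>x. x - (\<Sum>i\<in>I. scale (e i x) i) \<in> J"
    by (rule finite_complement_coordinates) blast
  let ?g = "\<lambda>i y. f (i \<cdot> y)"
  have e: "e i \<in> sweedler_dual" if "i \<in> I" for i
    using sweedler_dualI[OF I(2) J(2,3)] I(3) that by blast
  have g: "?g i \<in> sweedler_dual" for i by (rule sweedler_dual_translate[OF J])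
  define t where "t = (\<Sum>i\<in>I. tens fun_scale sweedler_dual fun_scale sweedler_dual (e i) (?g i))"
  have t: "t \<in> dual_tensor"
    unfolding t_def using e g
    by (intro fun_vs.subspace_sum[OF subspace_tensor_space] tens_in_tensor_space)
  have sum_f: "f (\<Sum>i\<in>S. h i) = (\<Sum>i\<in>S. f (h i))" for S and h :: "'g \<Rightarrow> 'g"
  proof -
    have "f 0 = 0" using J(4) subspace_0[OF sJ] .
    then show ?thesis
      by (induction S rule: infinite_finite_induct) (simp_all add: sweedler_dual_linear[OF assms])
  qed
  have sum_mult: "(\<Sum>i\<in>S. h i) \<cdot> y = (\<Sum>i\<in>S. h i \<cdot> y)" for S y and h :: "'g \<Rightarrow> 'g"
  proof -
    have "0 \<cdot> y = 0" using mult_linear(2)[of 0 0 y] by simp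
    then show ?thesis by (induction S rule: infinite_finite_induct) (simp_all add: mult_linear)
  qed
  have emb: "embedding t w = (\<Sum>i\<in>I. embedding (tens fun_scale sweedler_dual fun_scale sweedler_dual
      (e i) (?g i)) w)" for w
  proof -
    have "embedding (\<Sum>i\<in>S. h i) w = (\<Sum>i\<in>S. embedding (h i) w)" for S :: "'g set" and h
    proof -
      have "embedding 0 w = 0" by (simp add: canonical_embedding_def)
      then show ?thesis
        by (induction S rule: infinite_finite_induct) (simp_all add: canonical_embedding_linear)
    qed
    then show ?thesis unfolding t_def .
  qed
  have tens_eq: "embedding t (tens scale UNIV scale UNIV x y) = f (x \<cdot> y)" for x y
  proof -
    let ?x = "\<Sum>i\<in>I. scale (e i x) i"
    \<comment> \<open>The error \<open>x - ?x\<close> lies in \<open>J\<close>, hence so does its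
      product with \<open>y\<close>, and \<open>f\<close> vanishes there.\<close>
    have "f ((x - ?x) \<cdot> y) = 0" using I(4)[of x] J(2,4) by (auto simp: ideal_def)
    then have "f (x \<cdot> y) = f (?x \<cdot> y)"
      using mult_linear(1)[of "x - ?x" ?x y] by (simp add: sweedler_dual_linear[OF assms])
    also have "\<dots> = (\<Sum>i\<in>I. e i x * f (i \<cdot> y))"
      by (simp add: sum_mult sum_f mult_linear sweedler_dual_linear[OF assms])
    also have "\<dots> = embedding t (tens scale UNIV scale UNIV x y)"
      unfolding emb
      by (rule sum.cong) (simp_all add:
          canonical_embedding_tens[OF sweedler_dual_subset sweedler_dual_subset e g])
    finally show ?thesis ..
  qed
  \<comment> \<open>Linearity extends the identity from pure tensors to the tensor space; elsewhere
    both sides are 0 by definition.\<close>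
  have "embedding t w = mu_star f w" for w
  proof (cases "w \<in> tensor_space scale UNIV scale UNIV")
    case True
    \<comment> \<open>Additivity in the argument \<open>w\<close>, not in \<open>t\<close>: adding
      arguments adds the bilinear forms to which \<open>t\<close> is applied.\<close>
    have emb_add: "embedding t (w + w') = embedding t w + embedding t w'"
      if "w \<in> tensor_space scale UNIV scale UNIV" "w' \<in> tensor_space scale UNIV scale UNIV" for w w'
      using that fun_vs.subspace_add[OF subspace_tensor_space that]
        tensor_forms_add[OF t canonical_embedding_form canonical_embedding_form,
          OF sweedler_dual_subset sweedler_dual_subset that(1)
            sweedler_dual_subset sweedler_dual_subset that(2)]
      by (simp add: canonical_embedding_def)
    have sc: "embedding t (fun_scale c w) = c * embedding t w"
      if "w \<in> tensor_space scale UNIV scale UNIV" for c w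
      using that fun_vs.subspace_scale[OF subspace_tensor_space that]
        tensor_forms_scale[OF t canonical_embedding_form,
          OF sweedler_dual_subset sweedler_dual_subset that]
      by (simp add: canonical_embedding_def)
    from True have "embedding t w = f (\<mu> w)"
    proof (induction rule: tensor_induct)
      case zero
      have "0 \<in> tensor_space scale UNIV scale UNIV"
        by (rule fun_vs.subspace_0[OF subspace_tensor_space])
      from sc[OF this, of 0] linear_onD(3)[OF linear_\<mu> this, of 0]
      have "embedding t 0 = f (\<mu> 0)"
        using sweedler_dual_linear(2)[OF assms, of 0 0] by simp
      then show ?case .
    next
      case (add w w')
      then show ?case
        by (simp add: emb_add linear_onD[OF linear_\<mu>] sweedler_dual_linear[OF assms]
            del: plus_fun_apply)
    next
      case (scale c w)
      then show ?case
        by (simp add: sc linear_onD[OF linear_\<mu>] sweedler_dual_linear[OF assms]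
            del: fun_scale_apply)
    qed (rule tens_eq)
    with True show ?thesis by (simp add: mu_star_def)
  qed (simp_all add: canonical_embedding_def mu_star_def)
  with t show ?thesis by (auto intro!: image_eqI[of _ _ t])
qed

lemma sweedler_comult_in_tensor: "f \<in> sweedler_dual \<Longrightarrow> sweedler_comult f \<in> dual_tensor"
  unfolding sweedler_comult_def by (intro inv_into_into mu_star_in_embedding)

text \<open>The working description of the comultiplication: \<open>embedding\<close> undoes the
  choice made by \<open>inv_into\<close>. All later identities are checked on these values.\<close>

lemma sweedler_comult_eval:
  assumes "f \<in> sweedler_dual"
  shows "sweedler_comult f (\<lambda>g h. g x * h y) = f (x \<cdot> y)"
proof -
  let ?w = "tens scale UNIV scale UNIV x y"
  have w: "?w \<in> tensor_space scale UNIV scale UNIV" by (simp add: tens_in_tensor_space)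
  have ev: "?w (\<lambda>x y. g x * h y) = g x * h y" if "g \<in> sweedler_dual" "h \<in> sweedler_dual" for g h
    using product_form[of g scale UNIV h scale UNIV] that sweedler_dual_subset
    by (auto simp: tens_def)
  have "sweedler_comult f (\<lambda>g h. g x * h y) = sweedler_comult f (\<lambda>g h. ?w (\<lambda>x y. g x * h y))"
    by (rule sym, rule tensor_forms_cong[OF sweedler_comult_in_tensor[OF assms]
          canonical_embedding_form[OF sweedler_dual_subset sweedler_dual_subset w]
          product_form_eval ev])
  also have "\<dots> = embedding (sweedler_comult f) ?w"
    using w by (simp add: canonical_embedding_def)
  also have "embedding (sweedler_comult f) = mu_star f"
    unfolding sweedler_comult_def using mu_star_in_embedding[OF assms] by (rule f_inv_into_f)
  finally show ?thesis using w by (simp add: mu_star_def)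
qed

section \<open>The coalgebra axioms, checked by evaluation\<close>

lemmas dual_tensor_eqI = tensor_dual_eqI[OF subspace_sweedler_dual sweedler_dual_subset
    subspace_sweedler_dual sweedler_dual_subset]

lemmas dual_tensor_eqI3 = tensor_dual_eqI3[OF subspace_sweedler_dual sweedler_dual_subset
    subspace_sweedler_dual sweedler_dual_subset subspace_sweedler_dual sweedler_dual_subset]

text \<open>Although chosen by \<open>inv_into\<close>, the comultiplication is linear, because its
  values \<open>f (x \<cdot> y)\<close> determine it and are linear in \<open>f\<close>.\<close>

lemma linear_on_sweedler_comult:
  "linear_on fun_scale sweedler_dual fun_scale dual_tensor sweedler_comult"
  unfolding linear_on_def
proof (intro conjI ballI allI)
  show "sweedler_comult ` sweedler_dual \<subseteq> dual_tensor"
    using sweedler_comult_in_tensor by blast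
next
  fix f g assume "f \<in> sweedler_dual" "g \<in> sweedler_dual"
  then show "sweedler_comult (f + g) = sweedler_comult f + sweedler_comult g"
    by (intro dual_tensor_eqI sweedler_comult_in_tensor
        fun_vs.subspace_add[OF subspace_tensor_space] fun_vs.subspace_add[OF subspace_sweedler_dual])
      (simp_all add: sweedler_comult_eval fun_vs.subspace_add[OF subspace_sweedler_dual])
next
  fix c f assume "f \<in> sweedler_dual"
  then show "sweedler_comult (fun_scale c f) = fun_scale c (sweedler_comult f)"
    by (intro dual_tensor_eqI sweedler_comult_in_tensor
        fun_vs.subspace_scale[OF subspace_tensor_space] fun_vs.subspace_scale[OF subspace_sweedler_dual])
      (simp_all add: sweedler_comult_eval fun_vs.subspace_scale[OF subspace_sweedler_dual])
qed

text \<open>One argument for both twisting maps: at \<open>x\<close>, \<open>y\<close> the two sides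
  evaluate to \<open>f (\<gamma> (x \<cdot> y))\<close> and
  \<open>f (\<gamma> x \<cdot> \<gamma> y)\<close>.\<close>

lemma sweedler_comult_star:
  assumes "linear_on fun_scale sweedler_dual fun_scale sweedler_dual (\<lambda>f. f \<circ> \<gamma>)"
    and mult: "\<And>x y. \<gamma> (x \<cdot> y) = \<gamma> x \<cdot> \<gamma> y" and f: "f \<in> sweedler_dual"
  shows "sweedler_comult (f \<circ> \<gamma>) = tensor_map fun_scale sweedler_dual fun_scale sweedler_dual
    (\<lambda>f. f \<circ> \<gamma>) (\<lambda>f. f \<circ> \<gamma>) (sweedler_comult f)"
proof (rule dual_tensor_eqI)
  have f\<gamma>: "f \<circ> \<gamma> \<in> sweedler_dual" using linear_onD(1)[OF assms(1) f] .
  then show "sweedler_comult (f \<circ> \<gamma>) \<in> dual_tensor" by (rule sweedler_comult_in_tensor)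
  show "tensor_map fun_scale sweedler_dual fun_scale sweedler_dual
    (\<lambda>f. f \<circ> \<gamma>) (\<lambda>f. f \<circ> \<gamma>) (sweedler_comult f) \<in> dual_tensor"
    by (rule linear_onD(1)[OF linear_on_tensor_map[OF assms(1,1)] sweedler_comult_in_tensor[OF f]])
  show "sweedler_comult (f \<circ> \<gamma>) (\<lambda>f g. f x * g y) = tensor_map fun_scale sweedler_dual fun_scale
    sweedler_dual (\<lambda>f. f \<circ> \<gamma>) (\<lambda>f. f \<circ> \<gamma>) (sweedler_comult f) (\<lambda>f g. f x * g y)" for x y
    using f f\<gamma> by (simp add: tensor_map_def product_form_eval sweedler_comult_eval mult)
qed

text \<open>Evaluated at \<open>x, y, z\<close>, the two sides are \<open>f (\<alpha> x (y z))\<close> and \<open>f ((x y) \<beta> z)\<close>.\<close>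

lemma sweedler_comult_coassoc:
  assumes f: "f \<in> sweedler_dual"
  shows "tensor_assoc fun_scale sweedler_dual fun_scale sweedler_dual fun_scale sweedler_dual
      (tensor_map fun_scale sweedler_dual fun_scale dual_tensor alpha_star sweedler_comult
        (sweedler_comult f))
    = tensor_map fun_scale dual_tensor fun_scale sweedler_dual sweedler_comult beta_star
        (sweedler_comult f)"
proof -
  let ?C = sweedler_dual
  let ?l = "tensor_map fun_scale ?C fun_scale dual_tensor alpha_star sweedler_comult
        (sweedler_comult f)"
  let ?r = "tensor_map fun_scale dual_tensor fun_scale ?C sweedler_comult beta_star
        (sweedler_comult f)"
  note \<Delta>f = sweedler_comult_in_tensor[OF f]
  have l: "?l \<in> tensor_space fun_scale ?C fun_scale dual_tensor"
    by (rule linear_onD(1)[OF linear_on_tensor_map[OF linear_on_star(1) linear_on_sweedler_comult] \<Delta>f])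
  have r: "?r \<in> tensor_space fun_scale dual_tensor fun_scale ?C"
    by (rule linear_onD(1)[OF linear_on_tensor_map[OF linear_on_sweedler_comult linear_on_star(2)] \<Delta>f])
  have l': "tensor_assoc fun_scale ?C fun_scale ?C fun_scale ?C ?l
      \<in> tensor_space fun_scale dual_tensor fun_scale ?C"
    using l by (rule tensor_assoc_in_tensor_space[OF fun_vs.vector_space_axioms subspace_sweedler_dual])
  show ?thesis
  proof (rule dual_tensor_eqI3[OF l' r])
    fix x y z
    \<comment> \<open>The test form for three factors: evaluation at \<open>x\<close>,
      \<open>y\<close>, \<open>z\<close>.\<close>
    let ?b = "\<lambda>(p :: (('g \<Rightarrow> 'k) \<Rightarrow> ('g \<Rightarrow> 'k) \<Rightarrow> 'k) \<Rightarrow> 'k) (h :: 'g \<Rightarrow> 'k).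
      p (\<lambda>f g. f x * g y) * h z"
    have b: "?b \<in> bilinear_forms fun_scale dual_tensor fun_scale ?C"
      by (rule product_form_eval)
    note b' = tensor_assoc_form[OF fun_vs.vector_space_axioms subspace_sweedler_dual b]
    \<comment> \<open>The pullback of \<open>?b\<close> along the associator, in the shape given by
      \<open>tensor_assoc_def\<close>.\<close>
    let ?b' = "\<lambda>g r. r (\<lambda>y' z'. ?b (tens fun_scale ?C fun_scale ?C g y') z')"
    have b'_eval: "?b' g t = g x * t (\<lambda>h k. h y * k z)"
      if g: "g \<in> ?C" and t: "t \<in> dual_tensor" for g t
    proof -
      have "?b' g t = t (\<lambda>h k. g x * (h y * k z))"
        by (rule tensor_forms_cong[OF t b'(1)[OF g]])
          (auto simp: tens_def product_form_eval intro!: bilinear_formsI simp: algebra_simps)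
      also have "\<dots> = g x * t (\<lambda>h k. h y * k z)"
        by (rule tensor_forms_scale[OF t product_form_eval])
      finally show ?thesis .
    qed
    have "tensor_assoc fun_scale ?C fun_scale ?C fun_scale ?C ?l ?b
        = sweedler_comult f (\<lambda>g h. ?b' (alpha_star g) (sweedler_comult h))"
      using b b'(2) by (simp add: tensor_assoc_def tensor_map_def)
    \<comment> \<open>On the Sweedler dual, \<open>alpha_star\<close> moves \<open>x\<close> to
      \<open>\<alpha> x\<close> and the inner comultiplication merges \<open>y\<close> and
      \<open>z\<close> into their product.\<close>
    also have "\<dots> = sweedler_comult f (\<lambda>g h. g (\<alpha> x) * h (y \<cdot> z))"
      by (rule tensor_forms_cong[OF \<Delta>f tensor_map_form[OF linear_on_star(1)
              linear_on_sweedler_comult b'(2)] product_form_eval])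
        (simp add: b'_eval star_sweedler_dual sweedler_comult_in_tensor sweedler_comult_eval,
          simp add: alpha_star_def)
    also have "\<dots> = f (\<alpha> x \<cdot> (y \<cdot> z))" by (rule sweedler_comult_eval[OF f])
    also have "\<dots> = f ((x \<cdot> y) \<cdot> \<beta> z)" by (simp only: bihom_assoc)
    also have "\<dots> = sweedler_comult f (\<lambda>g h. g (x \<cdot> y) * h (\<beta> z))"
      by (rule sweedler_comult_eval[OF f, symmetric])
    also have "\<dots> = sweedler_comult f (\<lambda>g h. ?b (sweedler_comult g) (beta_star h))"
      by (rule tensor_forms_cong[OF \<Delta>f product_form_eval tensor_map_form[OF
              linear_on_sweedler_comult linear_on_star(2) b]])
        (simp add: sweedler_comult_eval, simp add: beta_star_def)
    also have "\<dots> = ?r ?b" using b by (simp add: tensor_map_def)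
    finally show "tensor_assoc fun_scale ?C fun_scale ?C fun_scale ?C ?l ?b = ?r ?b" .
  qed
qed

lemma alpha_star_eq: "alpha_star = (\<lambda>f. f \<circ> \<alpha>)" and beta_star_eq: "beta_star = (\<lambda>f. f \<circ> \<beta>)"
  by (auto simp: alpha_star_def beta_star_def)

text \<open>The order of the twisting maps is swapped: coassociativity puts the second map
  \<open>\<phi>\<close> on the left, where \<alpha> stands in \<open>bihom_assoc\<close>, so
  \<open>alpha_star\<close> comes last.\<close>

theorem bihom_coalgebra_sweedler_dual:
  "bihom_coalgebra fun_scale sweedler_dual sweedler_comult beta_star alpha_star"
proof
  fix f assume f: "f \<in> sweedler_dual"
  show "beta_star (alpha_star f) = alpha_star (beta_star f)"
    using commute by (simp add: alpha_star_def beta_star_def comp_assoc)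
  show "sweedler_comult (beta_star f) =
      tensor_map fun_scale sweedler_dual fun_scale sweedler_dual beta_star beta_star (sweedler_comult f)"
    using sweedler_comult_star[OF linear_on_star(2)[unfolded beta_star_eq] \<beta>_mult f]
    by (simp add: beta_star_eq)
  show "sweedler_comult (alpha_star f) =
      tensor_map fun_scale sweedler_dual fun_scale sweedler_dual alpha_star alpha_star (sweedler_comult f)"
    using sweedler_comult_star[OF linear_on_star(1)[unfolded alpha_star_eq] \<alpha>_mult f]
    by (simp add: alpha_star_eq)
qed (fact subspace_sweedler_dual linear_on_sweedler_comult linear_on_star sweedler_comult_coassoc)+

end

text \<open>The first inclusion guarantees that the preimage chosen in
  \<open>sweedler_comult\<close> exists; its uniqueness is
  \<open>inj_on_canonical_embedding\<close>.\<close>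

theorem theorem2:
  fixes scale :: "'k::field_char_0 \<Rightarrow> 'g::ab_group_add \<Rightarrow> 'g"
    and \<mu> :: "(('g \<Rightarrow> 'g \<Rightarrow> 'k) \<Rightarrow> 'k) \<Rightarrow> 'g"
    and \<alpha> \<beta> :: "'g \<Rightarrow> 'g"
  assumes "bihom_algebra scale \<mu> \<alpha> \<beta>"
  shows "let G_dual = bihom_algebra.sweedler_dual scale \<mu> \<alpha> \<beta>;
             \<Delta> = bihom_algebra.sweedler_comult scale \<mu> \<alpha> \<beta>;
             \<alpha>_dual = bihom_algebra.alpha_star \<alpha>;
             \<beta>_dual = bihom_algebra.beta_star \<beta>
         in bihom_algebra.mu_star scale \<mu> ` G_dual
              \<subseteq> canonical_embedding scale UNIV scale UNIV `
                  tensor_space fun_scale G_dual fun_scale G_dual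
          \<and> \<alpha>_dual ` G_dual \<subseteq> G_dual
          \<and> \<beta>_dual ` G_dual \<subseteq> G_dual
          \<and> bihom_coalgebra fun_scale G_dual \<Delta> \<beta>_dual \<alpha>_dual"
proof -
  interpret bihom_algebra scale \<mu> \<alpha> \<beta> by (rule assms)
  show ?thesis
    unfolding Let_def
    using mu_star_in_embedding star_sweedler_dual bihom_coalgebra_sweedler_dual by blast
qed

end
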